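(* Let $G$ be a connected graph of order $n\ge 3$. Then $\beta_p(G)\le \eta_p(G)\le \beta_p(G)+1$.
   Context: All graphs are finite, simple, undirected and connected. For a vertex $v$ and a set $S\subseteq V(G)$, $d(v,S)=\min\{d(v,w):w\in S\}$. For a partition $\Pi=\{S_1,\dots,S_k\}$ of $V(G)$ and $u\in V(G)$, let $r(u|\Pi)=(d(u,S_1),\dots,d(u,S_k))$. $\Pi$ is a resolving partition if $r(u|\Pi)\ne r(v|\Pi)$ for all distinct $u,v\in V(G)$. $\Pi$ is a dominating partition if for every $v\in V(G)$ there is $j$ with $d(v,S_j)=1$. A resolving dominating partition (RD-partition) is a partition that is both resolving and dominating. The partition dimension $\beta_p(G)$ is the minimum cardinality of a resolving partition of $G$; the dominating partition dimension $\eta_p(G)$ is the minimum cardinality of an RD-partition of $G$. *)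

theory Defs
  imports "Graph_Theory.Graph_Theory" "HOL-Library.Disjoint_Sets" "HOL-Library.FuncSet"
begin

definition graph_dist :: "('a, 'b) pre_digraph \<Rightarrow> 'a \<Rightarrow> 'a \<Rightarrow> ereal" where
  "graph_dist G u v = wf_digraph.\<mu> G (\<lambda>_. 1) u v"

definition dist_set :: "('a, 'b) pre_digraph \<Rightarrow> 'a \<Rightarrow> 'a set \<Rightarrow> ereal" where
  "dist_set G v S = Min {graph_dist G v w | w. w \<in> S}"

text \<open>The vector \<open>r(u|P)\<close> is indexed by the parts themselves, so no ordering of
  \<open>P\<close> has to be chosen.\<close>

definition part_rep :: "('a, 'b) pre_digraph \<Rightarrow> 'a set set \<Rightarrow> 'a \<Rightarrow> 'a set \<Rightarrow> ereal" where
  "part_rep G P u = (\<lambda>S\<in>P. dist_set G u S)"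

definition resolving_partition :: "('a, 'b) pre_digraph \<Rightarrow> 'a set set \<Rightarrow> bool" where
  "resolving_partition G P \<longleftrightarrow> partition_on (verts G) P \<and>
     (\<forall>u\<in>verts G. \<forall>v\<in>verts G. u \<noteq> v \<longrightarrow> part_rep G P u \<noteq> part_rep G P v)"

definition dominating_partition :: "('a, 'b) pre_digraph \<Rightarrow> 'a set set \<Rightarrow> bool" where
  "dominating_partition G P \<longleftrightarrow> partition_on (verts G) P \<and>
     (\<forall>v\<in>verts G. \<exists>S\<in>P. dist_set G v S = 1)"

definition RD_partition :: "('a, 'b) pre_digraph \<Rightarrow> 'a set set \<Rightarrow> bool" where
  "RD_partition G P \<longleftrightarrow> resolving_partition G P \<and> dominating_partition G P"

text \<open>The minima below are attained for connected graphs of order at least 2, since the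
  partition into singletons is then an RD-partition. A graph of order 1 has no
  dominating partition.\<close>

definition partition_dim :: "('a, 'b) pre_digraph \<Rightarrow> nat" where
  "partition_dim G = (LEAST k. \<exists>P. resolving_partition G P \<and> card P = k)"

definition dom_partition_dim :: "('a, 'b) pre_digraph \<Rightarrow> nat" where
  "dom_partition_dim G = (LEAST k. \<exists>P. RD_partition G P \<and> card P = k)"

end

(* Call a vertex interior if all its neighbours lie in its own part; these are exactly the
   vertices that a resolving partition P fails to dominate.  Let R be a maximal independent set
   of the graph induced on the interior vertices, and move R out of all parts of P into one new
   part.  Removing interior vertices from a part does not change the distance to it from outside,
   because that distance is attained at a vertex with a neighbour outside the part; so the new
   partition still resolves.  It dominates since R dominates the other interior vertices, and
   every vertex of R keeps, by independence, all its neighbours in its old part. *)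

theory Submission
  imports Defs
begin

section \<open>Symmetry of adjacency and maximal independent sets\<close>

lemma (in graph) dominates_sym: "u \<rightarrow>\<^bsub>G\<^esub> v \<Longrightarrow> v \<rightarrow>\<^bsub>G\<^esub> u"
  by (rule arcs_ends_symmetric[OF sym_arcs])

text \<open>Greedy choice: each new vertex joins \<open>R\<close> exactly when it has no neighbour
  in \<open>R\<close> so far. Symmetry of adjacency then excludes arcs in the other direction, and
  the absence of loops excludes an arc from the new vertex to itself.\<close>

lemma (in graph) ex_maximal_independent_set:
  assumes "finite W"
  shows "\<exists>R\<subseteq>W. (\<forall>x\<in>R. \<forall>y\<in>R. \<not> x \<rightarrow>\<^bsub>G\<^esub> y) \<and> (\<forall>w\<in>W - R. \<exists>r\<in>R. w \<rightarrow>\<^bsub>G\<^esub> r)"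
  using assms
proof (induction W)
  case empty
  then show ?case by auto
next
  case (insert w W)
  then obtain R where R: "R \<subseteq> W" "\<forall>x\<in>R. \<forall>y\<in>R. \<not> x \<rightarrow>\<^bsub>G\<^esub> y" "\<forall>w\<in>W - R. \<exists>r\<in>R. w \<rightarrow>\<^bsub>G\<^esub> r"
    by auto
  show ?case
  proof (cases "\<exists>r\<in>R. w \<rightarrow>\<^bsub>G\<^esub> r")
    case True
    then show ?thesis using R by (intro exI[of _ R]) auto
  next
    case False
    then show ?thesis
      using R adj_not_same dominates_sym by (intro exI[of _ "insert w R"]) blast
  qed
qed

section \<open>Walks and distances between two vertices\<close>

locale nontrivial_connected_graph = graph G for G :: "('a, 'b) pre_digraph" (structure) +
  assumes conn: "Digraph_Component.connected G"
    and nontrivial: "card (verts G) \<ge> 2"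
begin

lemma reachable_verts:
  assumes "u \<in> verts G" "v \<in> verts G"
  shows "u \<rightarrow>\<^sup>* v"
  using symmetric_connected_imp_strongly_connected[OF sym_arcs conn] assms
  unfolding strongly_connected_def by blast

lemma awalk_cost_one: "awalk_cost (\<lambda>_. 1) p = real (length p)"
  by (induction p) auto

lemma graph_dist_le_length:
  assumes "awalk u p v"
  shows "graph_dist G u v \<le> ereal (length p)"
  using min_cost_le_walk_cost[OF assms, of "\<lambda>_. 1"]
  by (simp add: graph_dist_def awalk_cost_one)

text \<open>With unit weights on a connected graph the infimum behind \<open>graph_dist\<close> is
  attained, so every distance is a natural number and can be handled as the length of a concrete
  walk.\<close>

lemma ex_shortest_awalk:
  assumes "u \<in> verts G" "v \<in> verts G"
  shows "\<exists>p. awalk u p v \<and> graph_dist G u v = ereal (length p)"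
  using min_cost_awalk[OF reachable_verts[OF assms], of "\<lambda>_. 1"]
  by (auto simp: graph_dist_def awalk_cost_one apath_def)

lemma graph_dist_self:
  assumes "u \<in> verts G"
  shows "graph_dist G u u = 0"
proof -
  have "awalk u [] u" using assms by (simp add: awalk_Nil_iff)
  from graph_dist_le_length[OF this] ex_shortest_awalk[OF assms assms] show ?thesis
    by (auto simp: zero_ereal_def)
qed

lemma graph_dist_pos:
  assumes "u \<in> verts G" "v \<in> verts G" "u \<noteq> v"
  shows "graph_dist G u v \<ge> 1"
proof -
  obtain p where p: "awalk u p v" "graph_dist G u v = ereal (length p)"
    using ex_shortest_awalk assms by blast
  have "p \<noteq> []" using p(1) assms(3) by (auto simp: awalk_Nil_iff)
  then show ?thesis using p(2) by (cases p) (auto simp: one_ereal_def)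
qed

lemma graph_dist_adj_le:
  assumes "u \<rightarrow>\<^bsub>G\<^esub> v"
  shows "graph_dist G u v \<le> 1"
proof -
  obtain e where e: "e \<in> arcs G" "tail G e = u" "head G e = v"
    using assms by (rule reachableE)
  show ?thesis
    using graph_dist_le_length[of u "[e]" v] arc_implies_awalk[OF e(1)] e
    by (simp add: one_ereal_def)
qed

text \<open>Dropping the last arc of a shortest walk to \<open>w\<close> leaves a walk to the last
  vertex before \<open>w\<close> that is shorter by one.\<close>

lemma graph_dist_predecessor:
  assumes "u \<in> verts G" "w \<in> verts G" "u \<noteq> w"
  shows "\<exists>x. x \<rightarrow>\<^bsub>G\<^esub> w \<and> graph_dist G u w \<ge> graph_dist G u x + 1"
proof -
  obtain p where p: "awalk u p w" "graph_dist G u w = ereal (length p)"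
    using ex_shortest_awalk assms by blast
  have "p \<noteq> []" using p(1) assms(3) by (auto simp: awalk_Nil_iff)
  then obtain q e where q: "p = q @ [e]" by (cases p rule: rev_cases) auto
  have aw: "awalk u q (tail G e)" "e \<in> arcs G" "head G e = w"
    using p(1) unfolding q by (auto simp: awalk_simps)
  have "tail G e \<rightarrow>\<^bsub>G\<^esub> w" using aw by (auto simp: arcs_ends_conv)
  moreover have "graph_dist G u (tail G e) + 1 \<le> graph_dist G u w"
    using add_right_mono[OF graph_dist_le_length[OF aw(1)], of 1] p(2) q
    by (simp add: one_ereal_def add.commute)
  ultimately show ?thesis by blast
qed

section \<open>Distances from a vertex to a set\<close>

lemma dist_set_attained:
  assumes "S \<subseteq> verts G" "S \<noteq> {}"
  shows "\<exists>w\<in>S. dist_set G v S = graph_dist G v w"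
    and "x \<in> S \<Longrightarrow> dist_set G v S \<le> graph_dist G v x"
proof -
  have fin: "finite (graph_dist G v ` S)"
    using assms(1) finite_verts finite_subset by blast
  have eq: "dist_set G v S = Min (graph_dist G v ` S)"
    unfolding dist_set_def by (rule arg_cong[of _ _ Min]) auto
  show "\<exists>w\<in>S. dist_set G v S = graph_dist G v w"
    using Min_in[OF fin] assms(2) unfolding eq by auto
  show "x \<in> S \<Longrightarrow> dist_set G v S \<le> graph_dist G v x"
    using fin unfolding eq by simp
qed

text \<open>Distinct vertices are at distance at least 1. Hence the zero coordinate of a
  representation reveals the part of the vertex.\<close>

lemma dist_set_eq_0_iff:
  assumes "S \<subseteq> verts G" "S \<noteq> {}" "v \<in> verts G"
  shows "dist_set G v S = 0 \<longleftrightarrow> v \<in> S"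
proof -
  obtain w where w: "w \<in> S" "dist_set G v S = graph_dist G v w"
    using dist_set_attained[OF assms(1,2)] by blast
  have "dist_set G v S \<ge> 1" if "v \<notin> S"
    using graph_dist_pos[of v w] w assms that by auto
  moreover have "dist_set G v S = 0" if "v \<in> S"
  proof -
    have "graph_dist G v w \<le> 0"
      using dist_set_attained(2)[OF assms(1,2) that, of v] graph_dist_self[OF assms(3)] w(2) by simp
    then have "\<not> 1 \<le> graph_dist G v w" by (auto simp: not_le intro: le_less_trans)
    then have "v = w" using graph_dist_pos[of v w] w(1) assms by auto
    then show ?thesis using w(2) graph_dist_self[OF assms(3)] by simp
  qed
  ultimately show ?thesis by (cases "v \<in> S") auto
qed

text \<open>A shortest walk of length 1 is a single arc. This turns domination into the existence of
  a neighbour in another part.\<close>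

lemma dist_set_eq_1_iff:
  assumes "S \<subseteq> verts G" "v \<in> verts G" "S \<noteq> {}"
  shows "dist_set G v S = 1 \<longleftrightarrow> v \<notin> S \<and> (\<exists>x\<in>S. v \<rightarrow>\<^bsub>G\<^esub> x)"
proof -
  obtain w where w: "w \<in> S" "dist_set G v S = graph_dist G v w"
    using dist_set_attained[OF assms(1,3)] by blast
  show ?thesis
  proof safe
    assume one: "dist_set G v S = 1"
    {
      assume "v \<in> S"
      then show False using dist_set_eq_0_iff[of S v] assms one by simp
    }
    then have "v \<noteq> w" using w by auto
    obtain p where p: "awalk v p w" "graph_dist G v w = ereal (length p)"
      using ex_shortest_awalk w assms by blast
    then have "length p = 1" using one w by (simp add: one_ereal_def)
    then obtain e where "p = [e]" by (auto simp: length_Suc_conv)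
    then have "v \<rightarrow>\<^bsub>G\<^esub> w" using p(1) by (auto simp: awalk_simps arcs_ends_conv)
    then show "\<exists>x\<in>S. v \<rightarrow>\<^bsub>G\<^esub> x" using w by blast
  next
    fix x
    assume x: "v \<notin> S" "x \<in> S" "v \<rightarrow>\<^bsub>G\<^esub> x"
    have "dist_set G v S \<le> 1"
      using dist_set_attained(2)[OF assms(1,3) x(2), of v] graph_dist_adj_le[OF x(3)]
      by (rule order_trans)
    moreover have "dist_set G v S \<ge> 1"
      using graph_dist_pos[of v w] w x(1) assms by auto
    ultimately show "dist_set G v S = 1" by (rule antisym)
  qed
qed

text \<open>If a vertex \<open>w\<close> of \<open>S\<close> nearest to \<open>u\<close> were in
  \<open>R\<close>, its predecessor on a shortest walk from \<open>u\<close> would be a neighbour of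
  \<open>w\<close>, hence in \<open>S\<close>, and closer to \<open>u\<close>. So the minimum over
  \<open>S\<close> is attained on \<open>S - R\<close>.\<close>

lemma dist_set_Diff_interior:
  assumes "S \<subseteq> verts G" "u \<in> verts G" "u \<notin> S" "S - R \<noteq> {}"
    and interior: "\<And>r x. r \<in> S \<Longrightarrow> r \<in> R \<Longrightarrow> r \<rightarrow>\<^bsub>G\<^esub> x \<Longrightarrow> x \<in> S"
  shows "dist_set G u (S - R) = dist_set G u S"
proof (rule antisym)
  have sub: "S - R \<subseteq> verts G" and ne: "S \<noteq> {}" using assms by auto
  obtain w where w: "w \<in> S" "dist_set G u S = graph_dist G u w"
    using dist_set_attained(1)[OF assms(1) ne] by blast
  have "w \<notin> R"
  proof
    assume "w \<in> R"
    obtain x where x: "x \<rightarrow>\<^bsub>G\<^esub> w" "graph_dist G u w \<ge> graph_dist G u x + 1"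
      using graph_dist_predecessor[of u w] w assms by auto
    have "x \<in> S" using interior \<open>w \<in> R\<close> w(1) dominates_sym[OF x(1)] by blast
    then have "graph_dist G u w \<le> graph_dist G u x"
      using dist_set_attained(2)[OF assms(1) ne] w(2) by metis
    \<comment> \<open>Finiteness is needed for the contradiction: an infinite \<open>ereal\<close>
      would absorb the added 1.\<close>
    moreover obtain k :: nat where "graph_dist G u x = ereal k"
      using ex_shortest_awalk[OF assms(2) subsetD[OF assms(1) \<open>x \<in> S\<close>]] by blast
    ultimately show False
      using x(2) by (cases "graph_dist G u w") (auto simp: one_ereal_def)
  qed
  then show "dist_set G u (S - R) \<le> dist_set G u S"
    using dist_set_attained(2)[OF sub assms(4)] w by auto
  show "dist_set G u S \<le> dist_set G u (S - R)"
    using dist_set_attained(1)[OF sub assms(4), of u] dist_set_attained(2)[OF assms(1) ne, of _ u]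
    by auto
qed

section \<open>From a resolving partition to an RD-partition\<close>

lemma ex_neighbour:
  assumes "v \<in> verts G"
  shows "\<exists>w. v \<rightarrow>\<^bsub>G\<^esub> w"
proof -
  have "verts G \<noteq> {v}" using nontrivial by auto
  \<comment> \<open>A shortest walk from a second vertex \<open>u\<close> ends with an arc into
    \<open>v\<close>.\<close>
  then obtain u where "u \<in> verts G" "u \<noteq> v" using assms by blast
  then show ?thesis using graph_dist_predecessor[of u v] assms dominates_sym by blast
qed

text \<open>Outside \<open>P\<close> both restricted functions are \<open>undefined\<close>, so
  equality of functions compares only the distances to the parts.\<close>

lemma part_rep_eq_iff:
  "part_rep G P u = part_rep G P v \<longleftrightarrow> (\<forall>S\<in>P. dist_set G u S = dist_set G v S)"
  unfolding part_rep_def by (auto simp: fun_eq_iff restrict_def)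

lemma ex_RD_partition_card_le:
  assumes res: "resolving_partition G P"
  shows "\<exists>Q. RD_partition G Q \<and> card Q \<le> card P + 1"
proof -
  have part: "partition_on (verts G) P" using res by (simp add: resolving_partition_def)
  have finP: "finite P" by (rule finite_elements[OF finite_verts part])
  have sub: "S \<subseteq> verts G" if "S \<in> P" for S
    using part that by (auto simp: partition_on_def)
  have ex_part: "\<exists>S\<in>P. v \<in> S" if "v \<in> verts G" for v
    using part that by (auto simp: partition_on_def)
  have same: "S = T" if "S \<in> P" "T \<in> P" "x \<in> S" "x \<in> T" for S T x
    using part that by (auto simp: partition_on_def disjoint_def)
  define W where "W = {v \<in> verts G. \<forall>S\<in>P. v \<in> S \<longrightarrow> (\<forall>x. v \<rightarrow>\<^bsub>G\<^esub> x \<longrightarrow> x \<in> S)}"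
  have "finite W" unfolding W_def by simp
  then obtain R where R: "R \<subseteq> W" "\<And>x y. x \<in> R \<Longrightarrow> y \<in> R \<Longrightarrow> \<not> x \<rightarrow>\<^bsub>G\<^esub> y"
    "\<And>w. w \<in> W - R \<Longrightarrow> \<exists>r\<in>R. w \<rightarrow>\<^bsub>G\<^esub> r"
    using ex_maximal_independent_set[of W] by auto
  have RV: "R \<subseteq> verts G" using R(1) by (auto simp: W_def)
  have int: "x \<in> S" if "r \<in> R" "S \<in> P" "r \<in> S" "r \<rightarrow>\<^bsub>G\<^esub> x" for r S x
    using R(1) that by (auto simp: W_def)
  \<comment> \<open>Some neighbour of \<open>r\<close> exists, lies in \<open>S\<close> because
    \<open>r\<close> is interior, and avoids \<open>R\<close> by independence. This serves three
    times: trimmed parts are nonempty, \<open>R\<close> is dominated, and vertices of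
    \<open>R\<close> remain traceable to their old part.\<close>
  have nbr: "\<exists>y\<in>S - R. r \<rightarrow>\<^bsub>G\<^esub> y" if "r \<in> R" "S \<in> P" "r \<in> S" for r S
    using ex_neighbour[of r] RV int R(2) that by blast
  have ne: "S - R \<noteq> {}" if "S \<in> P" for S
  proof -
    have "S \<noteq> {}" using part that by (auto simp: partition_on_def)
    then show ?thesis using nbr that by blast
  qed
  have dist_diff: "dist_set G u (S - R) = dist_set G u S"
    if "S \<in> P" "u \<in> verts G" "u \<notin> S" for S u
    using dist_set_Diff_interior[OF sub that(2,3) ne] int that by blast
  \<comment> \<open>\<open>R\<close> is empty exactly when no vertex is interior; then
    \<open>{R} - {{}}\<close> adds no part, which keeps the empty set out of
    \<open>Q\<close>.\<close>
  define Q where "Q = (\<lambda>S. S - R) ` P \<union> ({R} - {{}})"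
  have partQ: "partition_on (verts G) Q"
  proof (rule partition_onI)
    show "\<Union>Q = verts G"
    proof
      show "\<Union>Q \<subseteq> verts G" using RV sub by (auto simp: Q_def)
      show "verts G \<subseteq> \<Union>Q"
      proof
        fix v
        assume "v \<in> verts G"
        then obtain S where "S \<in> P" "v \<in> S" using ex_part by blast
        then show "v \<in> \<Union>Q" by (cases "v \<in> R") (auto simp: Q_def)
      qed
    qed
    show "{} \<notin> Q" using ne by (auto simp: Q_def)
    show "disjnt A B" if "A \<in> Q" "B \<in> Q" "A \<noteq> B" for A B
    proof (rule ccontr)
      assume "\<not> disjnt A B"
      then obtain x where x: "x \<in> A" "x \<in> B" by (auto simp: disjnt_def)
      \<comment> \<open>The part of \<open>P\<close> containing \<open>x\<close> determines which
        member of \<open>Q\<close> contains \<open>x\<close>, so \<open>A\<close> and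
        \<open>B\<close> must coincide.\<close>
      have part_of_x: "C = (if x \<in> R then R else S - R)"
        if "C \<in> Q" "x \<in> C" "S \<in> P" "x \<in> S" for C S
      proof -
        consider "C = R" | T where "T \<in> P" "C = T - R"
          using \<open>C \<in> Q\<close> unfolding Q_def by blast
        then show ?thesis
        proof cases
          case 1
          then show ?thesis using \<open>x \<in> C\<close> by simp
        next
          case 2
          then have "x \<in> T" "x \<notin> R" using \<open>x \<in> C\<close> by blast+
          then show ?thesis using same[OF 2(1) that(3) _ that(4)] 2(2) by simp
        qed
      qed
      have "x \<in> verts G" using UnionI[OF that(1) x(1)] \<open>\<Union>Q = verts G\<close> by simp
      then obtain S where "S \<in> P" "x \<in> S" using ex_part by auto
      then show False
        using part_of_x[OF that(1) x(1)] part_of_x[OF that(2) x(2)] that(3) by metis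
    qed
  qed
  have subQ: "A \<subseteq> verts G" "A \<noteq> {}" if "A \<in> Q" for A
    using partQ that by (auto simp: partition_on_def)
  have Diff_Q: "S - R \<in> Q" if "S \<in> P" for S using that by (auto simp: Q_def)
  have one: "dist_set G v A = 1" if "A \<in> Q" "v \<in> verts G" "v \<notin> A" "x \<in> A" "v \<rightarrow>\<^bsub>G\<^esub> x" for A v x
    using dist_set_eq_1_iff[OF subQ(1)[OF that(1)] that(2) subQ(2)[OF that(1)]] that by blast
  have "\<exists>A\<in>Q. dist_set G v A = 1" if v: "v \<in> verts G" for v
  proof -
    obtain S where S: "S \<in> P" "v \<in> S" using ex_part v by blast
    consider "v \<in> R" | "v \<in> W - R" | "v \<notin> W" by blast
    then show ?thesis
    proof cases
      case 1
      then show ?thesis using nbr[OF _ S] one[OF Diff_Q[OF S(1)] v] Diff_Q[OF S(1)] by blast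
    next
      case 2
      then obtain r where r: "r \<in> R" "v \<rightarrow>\<^bsub>G\<^esub> r" using R(3) by blast
      then have "R \<in> Q" by (auto simp: Q_def)
      then show ?thesis using one[OF _ v, of R r] r 2 by blast
    next
      case 3
      then obtain S' x where "S' \<in> P" "v \<in> S'" and x: "v \<rightarrow>\<^bsub>G\<^esub> x" "x \<notin> S'"
        using v by (auto simp: W_def)
      then have "x \<notin> S" using same[OF S(1) _ S(2)] by auto
      obtain T where T: "T \<in> P" "x \<in> T" using ex_part adj_in_verts(2)[OF x(1)] by blast
      have "v \<notin> T" using same[OF S(1) T(1) S(2)] T \<open>x \<notin> S\<close> by blast
      \<comment> \<open>If \<open>x\<close> were in \<open>R\<close>, it would be interior and its
        neighbour \<open>v\<close> would lie in \<open>T\<close>.\<close>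
      moreover from this have "x \<notin> R" using int[OF _ T] dominates_sym[OF x(1)] by blast
      ultimately show ?thesis using one[OF Diff_Q[OF T(1)] v _ _ x(1)] Diff_Q[OF T(1)] T by blast
    qed
  qed
  \<comment> \<open>Equal representations under \<open>Q\<close> are shown to give equal
    representations under \<open>P\<close>: first \<open>u\<close> and \<open>v\<close> lie in one
    part of \<open>P\<close>, then the distances to all parts of \<open>P\<close> agree.\<close>
  moreover have "part_rep G Q u \<noteq> part_rep G Q v"
    if uv: "u \<in> verts G" "v \<in> verts G" "u \<noteq> v" for u v
  proof
    assume "part_rep G Q u = part_rep G Q v"
    then have eq: "dist_set G u A = dist_set G v A" if "A \<in> Q" for A
      using that by (simp add: part_rep_eq_iff)
    have mem: "u \<in> A \<longleftrightarrow> v \<in> A" if "A \<in> Q" for A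
      using dist_set_eq_0_iff[OF subQ[OF that]] eq[OF that] uv by metis
    \<comment> \<open>For empty \<open>R\<close>, which is not a member of \<open>Q\<close>, both
      sides are false.\<close>
    have memR: "u \<in> R \<longleftrightarrow> v \<in> R" using mem[of R] by (cases "R = {}") (auto simp: Q_def)
    obtain S where S: "S \<in> P" "u \<in> S" using ex_part uv by blast
    obtain T where T: "T \<in> P" "v \<in> T" using ex_part uv by blast
    have "v \<in> S"
    proof (cases "u \<in> R")
      case False
      then show ?thesis using mem[OF Diff_Q[OF S(1)]] S by blast
    next
      case True
      \<comment> \<open>The vertex \<open>u\<close> has distance 1 to \<open>S - R\<close>, so
        \<open>v\<close> has too. As \<open>v\<close> is also in \<open>R\<close> and thus interior,
        its neighbour in \<open>S - R\<close> lies in its own part \<open>T\<close>, which forces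
        \<open>S = T\<close>.\<close>
      then obtain y where "y \<in> S - R" "u \<rightarrow>\<^bsub>G\<^esub> y" using nbr[OF _ S] by blast
      then have "dist_set G v (S - R) = 1"
        using one[OF Diff_Q[OF S(1)] uv(1)] eq[OF Diff_Q[OF S(1)]] True by auto
      then obtain z where z: "z \<in> S - R" "v \<rightarrow>\<^bsub>G\<^esub> z"
        using dist_set_eq_1_iff[of "S - R" v] subQ[OF Diff_Q[OF S(1)]] uv by blast
      then have "z \<in> T" using int[OF _ T] True memR by blast
      then show ?thesis using same[OF S(1) T(1)] z T by blast
    qed
    \<comment> \<open>Both distances to \<open>S\<close> are 0. Any other part contains neither
      vertex, so trimming it by \<open>R\<close> leaves both distances unchanged.\<close>
    have "dist_set G u A = dist_set G v A" if A: "A \<in> P" for A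
    proof (cases "A = S")
      case True
      then show ?thesis
        using dist_set_eq_0_iff[OF sub[OF S(1)]] S \<open>v \<in> S\<close> uv by (metis empty_iff)
    next
      case False
      then have "u \<notin> A" "v \<notin> A" using same[OF A S(1)] S \<open>v \<in> S\<close> by blast+
      then show ?thesis using dist_diff[OF A] eq[OF Diff_Q[OF A]] uv by metis
    qed
    then have "part_rep G P u = part_rep G P v" by (simp add: part_rep_eq_iff)
    then show False using res uv by (auto simp: resolving_partition_def)
  qed
  ultimately have "RD_partition G Q"
    using partQ
    by (auto simp: RD_partition_def resolving_partition_def dominating_partition_def)
  moreover have "card Q \<le> card P + 1"
  proof -
    have "card Q \<le> card ((\<lambda>S. S - R) ` P) + card ({R} - {{}})"
      unfolding Q_def by (rule card_Un_le)
    also have "\<dots> \<le> card P + 1"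
      using card_image_le[OF finP, of "\<lambda>S. S - R"] card_Diff1_le[of "{R}" "{}"] by simp
    finally show ?thesis .
  qed
  ultimately show ?thesis by blast
qed

section \<open>The two dimensions as attained minima\<close>

lemma ex_resolving_partition: "\<exists>P. resolving_partition G P"
proof -
  let ?P = "(\<lambda>v. {v}) ` verts G"
  have "partition_on (verts G) ?P"
    by (rule partition_onI) (auto simp: disjnt_def)
  \<comment> \<open>The coordinate at \<open>{u}\<close> is 0 for \<open>u\<close> but not for
    \<open>v\<close>.\<close>
  moreover have "part_rep G ?P u \<noteq> part_rep G ?P v"
    if "u \<in> verts G" "v \<in> verts G" "u \<noteq> v" for u v
    using dist_set_eq_0_iff[of "{u}" u] dist_set_eq_0_iff[of "{u}" v] that
    by (auto simp: part_rep_eq_iff intro!: bexI[of _ u])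
  ultimately show ?thesis by (auto simp: resolving_partition_def)
qed

lemma partition_dim_attained: "\<exists>P. resolving_partition G P \<and> card P = partition_dim G"
proof -
  obtain P where "resolving_partition G P" using ex_resolving_partition by blast
  then show ?thesis
    unfolding partition_dim_def
    by (intro LeastI[of "\<lambda>k. \<exists>P. resolving_partition G P \<and> card P = k" "card P"] exI[of _ P]) simp
qed

text \<open>Some RD-partition exists because any resolving partition, such as the one into
  singletons, can be converted into one.\<close>

lemma dom_partition_dim_attained: "\<exists>Q. RD_partition G Q \<and> card Q = dom_partition_dim G"
proof -
  obtain Q where "RD_partition G Q"
    using ex_resolving_partition ex_RD_partition_card_le by metis
  then show ?thesis
    unfolding dom_partition_dim_def
    by (intro LeastI[of "\<lambda>k. \<exists>Q. RD_partition G Q \<and> card Q = k" "card Q"] exI[of _ Q]) simp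
qed

lemma partition_dim_le_dom_partition_dim: "partition_dim G \<le> dom_partition_dim G"
proof -
  obtain Q where "RD_partition G Q" "card Q = dom_partition_dim G"
    using dom_partition_dim_attained by blast
  then show ?thesis
    unfolding partition_dim_def by (intro Least_le exI[of _ Q]) (simp add: RD_partition_def)
qed

lemma dom_partition_dim_le_Suc_partition_dim: "dom_partition_dim G \<le> partition_dim G + 1"
proof -
  obtain Q where "RD_partition G Q" "card Q \<le> partition_dim G + 1"
    using partition_dim_attained ex_RD_partition_card_le by metis
  moreover from this(1) have "dom_partition_dim G \<le> card Q"
    unfolding dom_partition_dim_def by (intro Least_le exI[of _ Q]) simp
  ultimately show ?thesis by linarith
qed

end

theorem mainTheorem1:
  fixes G :: "('a, 'b) pre_digraph"
  assumes "graph G"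
    and "Digraph_Component.connected G"
    and "card (verts G) \<ge> 3"
  shows "partition_dim G \<le> dom_partition_dim G \<and> dom_partition_dim G \<le> partition_dim G + 1"
proof -
  interpret nontrivial_connected_graph G
    using assms by (simp add: nontrivial_connected_graph_def nontrivial_connected_graph_axioms_def)
  show ?thesis
    using partition_dim_le_dom_partition_dim dom_partition_dim_le_Suc_partition_dim by blast
qed

end
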